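(* Let $n,k$ be nonnegative integers and $s>0$ an integer, and let $r$ be the remainder of $k$ upon division by $s+1$. Then \[ {n+k \brace n}^{(s)}=\sum _{i = 0}^{\min \{\lfloor \frac{n-r}{s+1}\rfloor ,\lfloor \frac{k}{s+1}\rfloor \}}h_{\lfloor \frac{k}{s+1}\rfloor -i}(1^{s+1},2^{s+1},\dots ,n^{s+1})\,{n+1\brack n+1-r-i(s+1)}. \]
   Context: ${n+k \brace n}^{(s)}:=M_{k}^{(s)}(1,2,\dots,n)$, where $M_{k}^{(s)}(x_{1},\ldots,x_{n})=\sum x_{1}^{a_{1}}\cdots x_{n}^{a_{n}}$, the sum over all $n$-tuples of nonnegative integers $(a_1,\dots,a_n)$ with $a_1+\cdots+a_n=k$ and each $a_i\equiv 0$ or $1 \pmod{s+1}$. Here $h_m$ is the complete homogeneous symmetric polynomial of degree $m$ (with $h_0=1$), and ${N \brack j}$ denotes the unsigned Stirling number of the first kind (number of permutations of $[N]$ with $j$ cycles), determined by $x(x+1)\cdots(x+N-1)=\sum_{j=0}^N {N\brack j}x^j$. *)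

theory Defs
  imports
    "HOL-Number_Theory.Cong"
    "HOL-Combinatorics.Stirling"
    "HOL-Library.FuncSet"
begin

text \<open>
  Exponent tuples \<open>(a\<^sub>1, \<dots>, a\<^sub>n)\<close> of nonnegative integers with sum \<open>m\<close>. They are functions on
  \<open>{1..n}\<close>, \<open>undefined\<close> elsewhere, so that each tuple is counted exactly once.
\<close>

definition exponents :: "nat \<Rightarrow> nat \<Rightarrow> (nat \<Rightarrow> nat) set" where
  "exponents n m = {a \<in> {1..n} \<rightarrow>\<^sub>E UNIV. (\<Sum>i=1..n. a i) = m}"

lemma finite_exponents: "finite (exponents n m)"
proof (rule finite_subset)
  show "exponents n m \<subseteq> {1..n} \<rightarrow>\<^sub>E {..m}"
    by (fastforce simp: exponents_def PiE_iff extensional_def intro: member_le_sum)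
  show "finite ({1..n} \<rightarrow>\<^sub>E {..m})"
    by (intro finite_PiE) auto
qed

text \<open>
  The symmetric polynomials below are given by their values at a point \<open>(x 1, \<dots>, x n)\<close> of an
  arbitrary commutative semiring.
\<close>

definition complete_homogeneous :: "nat \<Rightarrow> nat \<Rightarrow> (nat \<Rightarrow> 'a::comm_semiring_1) \<Rightarrow> 'a" where
  "complete_homogeneous m n x = (\<Sum>a\<in>exponents n m. \<Prod>i=1..n. x i ^ a i)"

definition modular_symmetric ::
    "nat \<Rightarrow> nat \<Rightarrow> nat \<Rightarrow> (nat \<Rightarrow> 'a::comm_semiring_1) \<Rightarrow> 'a" where
  "modular_symmetric s k n x =
     (\<Sum>a | a \<in> exponents n k \<and> (\<forall>i\<in>{1..n}. [a i = 0] (mod (s + 1)) \<or> [a i = 1] (mod (s + 1))).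
        \<Prod>i=1..n. x i ^ a i)"

text \<open>
  The number written as a brace symbol with upper entry \<open>n + k\<close>, lower entry \<open>n\<close> and superscript
  \<open>(s)\<close>: the arguments are \<open>s\<close>, \<open>n\<close> and the difference \<open>k\<close> of the two entries.
\<close>

definition modular_stirling :: "nat \<Rightarrow> nat \<Rightarrow> nat \<Rightarrow> nat" where
  "modular_stirling s n k = modular_symmetric s k n (\<lambda>i. i)"

end

theory Submission
  imports Defs "HOL-Computational_Algebra.Formal_Power_Series"
begin

text \<open>
  Compare the coefficients of \<open>z ^ k\<close> in
  \<open>(\<Prod>i. (1 + x\<^sub>i z) / (1 - (x\<^sub>i z) ^ (s + 1)))
    = (\<Prod>i. 1 + x\<^sub>i z) * (\<Prod>i. 1 / (1 - (x\<^sub>i z) ^ (s + 1)))\<close>. The left-hand side generates the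
  modular symmetric polynomials, since an exponent is congruent to 0 or 1 modulo \<open>s + 1\<close> exactly
  if it is a multiple of \<open>s + 1\<close> plus 0 or 1, uniquely so for \<open>s > 0\<close>. At \<open>x\<^sub>i = i\<close> the first factor on
  the right generates the Stirling numbers of the first kind, and the second factor generates
  the complete homogeneous polynomials in the \<open>x\<^sub>i ^ (s + 1)\<close>.
\<close>

unbundle fps_syntax

text \<open>Splitting off the last exponent \<open>m - j\<close> leaves an \<open>n\<close>-tuple
  with sum \<open>j\<close>. This is the shape of a Cauchy product, as an induction on the number of
  factors requires.\<close>

lemma sum_exponents_Suc:
  fixes F :: "(nat \<Rightarrow> nat) \<Rightarrow> 'a::comm_monoid_add"
  shows "(\<Sum>a\<in>exponents (Suc n) m. F a)
    = (\<Sum>j=0..m. \<Sum>a\<in>exponents n j. F (a(Suc n := m - j)))"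
proof -
  have "(\<Sum>j=0..m. \<Sum>a\<in>exponents n j. F (a(Suc n := m - j)))
    = (\<Sum>(j, a)\<in>Sigma {0..m} (exponents n). F (a(Suc n := m - j)))"
    by (simp add: sum.Sigma finite_exponents)
  also have "\<dots> = (\<Sum>a\<in>exponents (Suc n) m. F a)"
  proof (rule sum.reindex_bij_witness
      \<comment> \<open>Tuples in \<open>exponents n\<close> are \<open>undefined\<close> outside
        \<open>{1..n}\<close>, so the dropped entry must be reset to that value.\<close>
      [where i = "\<lambda>a. (m - a (Suc n), a(Suc n := undefined))"
         and j = "\<lambda>(j, a). a(Suc n := m - j)"])
    fix p assume "p \<in> Sigma {0..m} (exponents n)"
    then show "(m - (case p of (j, a) \<Rightarrow> a(Suc n := m - j)) (Suc n),
        (case p of (j, a) \<Rightarrow> a(Suc n := m - j))(Suc n := undefined)) = p"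
      by (auto simp: exponents_def PiE_iff extensional_def)
  next
    fix p assume "p \<in> Sigma {0..m} (exponents n)"
    then show "(case p of (j, a) \<Rightarrow> a(Suc n := m - j)) \<in> exponents (Suc n) m"
      by (auto simp: exponents_def PiE_iff extensional_def)
  next
    fix a assume "a \<in> exponents (Suc n) m"
    then show "(m - a (Suc n), a(Suc n := undefined)) \<in> Sigma {0..m} (exponents n)"
      by (auto simp: exponents_def PiE_iff extensional_def)
  qed (auto simp: exponents_def)
  finally show ?thesis ..
qed

lemma fps_prod_nth_exponents:
  fixes f :: "nat \<Rightarrow> 'a::comm_semiring_1 fps"
  shows "(\<Prod>i=1..n. f i) $ m = (\<Sum>a\<in>exponents n m. \<Prod>i=1..n. f i $ a i)"
proof (induction n arbitrary: m)
  case 0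
  have "exponents 0 m = (if m = 0 then {\<lambda>_. undefined} else {})"
    by (auto simp: exponents_def)
  then show ?case by simp
next
  case (Suc n)
  have "(\<Prod>i=1..Suc n. f i) $ m = (\<Sum>j=0..m. (\<Prod>i=1..n. f i) $ j * f (Suc n) $ (m - j))"
    by (simp add: fps_mult_nth)
  also have "\<dots> = (\<Sum>j=0..m. \<Sum>a\<in>exponents n j.
      \<Prod>i=1..Suc n. f i $ ((a(Suc n := m - j)) i))"
    by (simp add: Suc.IH [simplified] sum_distrib_right)
  also have "\<dots> = (\<Sum>a\<in>exponents (Suc n) m. \<Prod>i=1..Suc n. f i $ a i)"
    by (rule sum_exponents_Suc [symmetric])
  finally show ?case .
qed

text \<open>One inadmissible exponent makes the whole product vanish, so a condition on each factor
  becomes a condition on all entries of the tuple.\<close>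

lemma modular_symmetric_fps:
  "modular_symmetric s k n x = (\<Prod>i=1..n. Abs_fps (\<lambda>a.
     if [a = 0] (mod (s + 1)) \<or> [a = 1] (mod (s + 1)) then x i ^ a else 0)) $ k"
proof -
  let ?P = "\<lambda>a::nat. [a = 0] (mod (s + 1)) \<or> [a = 1] (mod (s + 1))"
  have "(\<Prod>i=1..n. if ?P (a i) then x i ^ a i else 0)
      = (if \<forall>i\<in>{1..n}. ?P (a i) then \<Prod>i=1..n. x i ^ a i else 0)" for a
    by (auto intro!: prod.cong prod_zero)
  then show ?thesis
    unfolding fps_prod_nth_exponents modular_symmetric_def
    by (simp add: sum.If_cases finite_exponents Int_def)
qed

lemma bij_betw_exponents_mult:
  assumes "d > 0"
  shows "bij_betw (\<lambda>a. \<lambda>i\<in>{1..n}. d * a i) (exponents n m)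
    {a \<in> exponents n (d * m). \<forall>i\<in>{1..n}. d dvd a i}"
proof (rule bij_betw_byWitness [where f' = "\<lambda>a. \<lambda>i\<in>{1..n}. a i div d"])
  show "(\<lambda>a. \<lambda>i\<in>{1..n}. a i div d) ` {a \<in> exponents n (d * m). \<forall>i\<in>{1..n}. d dvd a i}
    \<subseteq> exponents n m"
  proof clarify
    fix a assume a: "a \<in> exponents n (d * m)" "\<forall>i\<in>{1..n}. d dvd a i"
    then have "d * (\<Sum>i=1..n. a i div d) = d * m"
      by (simp add: exponents_def sum_distrib_left)
    then show "(\<lambda>i\<in>{1..n}. a i div d) \<in> exponents n m"
      using assms by (simp add: exponents_def)
  qed
qed (use assms in \<open>auto simp: exponents_def PiE_iff extensional_def restrict_def fun_eq_iff
       sum_distrib_left [symmetric]\<close>)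

text \<open>Each factor is the geometric series of \<open>(x i * z) ^ d\<close>, written by its
  coefficients because a semiring has no division. Dividing all exponents by \<open>d\<close> turns
  its monomials into those in the \<open>x i ^ d\<close>.\<close>

lemma complete_homogeneous_fps:
  assumes "d > 0"
  shows "(\<Prod>i=1..n. Abs_fps (\<lambda>a. if d dvd a then x i ^ a else 0)) $ m
    = (if d dvd m then complete_homogeneous (m div d) n (\<lambda>i. x i ^ d) else 0)"
proof -
  have "(\<Prod>i=1..n. if d dvd a i then x i ^ a i else 0)
      = (if \<forall>i\<in>{1..n}. d dvd a i then \<Prod>i=1..n. x i ^ a i else 0)" for a
    by (auto intro!: prod.cong prod_zero)
  then have coeff: "(\<Prod>i=1..n. Abs_fps (\<lambda>a. if d dvd a then x i ^ a else 0)) $ m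
      = (\<Sum>a | a \<in> exponents n m \<and> (\<forall>i\<in>{1..n}. d dvd a i). \<Prod>i=1..n. x i ^ a i)"
    unfolding fps_prod_nth_exponents by (simp add: sum.If_cases finite_exponents Int_def)
  show ?thesis
  proof (cases "d dvd m")
    case True
    then have m: "d * (m div d) = m" by simp
    have "complete_homogeneous (m div d) n (\<lambda>i. x i ^ d)
      = (\<Sum>a\<in>exponents n (m div d). \<Prod>i=1..n. x i ^ ((\<lambda>i\<in>{1..n}. d * a i) i))"
      unfolding complete_homogeneous_def by (intro sum.cong prod.cong) (auto simp: power_mult)
    also have "\<dots> = (\<Sum>a | a \<in> exponents n m \<and> (\<forall>i\<in>{1..n}. d dvd a i). \<Prod>i=1..n. x i ^ a i)"
      using sum.reindex_bij_betw [OF bij_betw_exponents_mult [OF assms, of n "m div d"],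
          of "\<lambda>a. \<Prod>i=1..n. x i ^ a i"]
      unfolding m by simp
    finally show ?thesis using True coeff by simp
  next
    case False
    then have "{a. a \<in> exponents n m \<and> (\<forall>i\<in>{1..n}. d dvd a i)} = {}"
      by (auto simp: exponents_def intro: dvd_sum)
    then show ?thesis using False by (simp only: coeff if_False sum.empty)
  qed
qed

text \<open>Multiplying by the factor for \<open>Suc n\<close> reproduces the Stirling recurrence.
  For \<open>j > n\<close> truncated subtraction gives lower index 0, where
  \<open>stirling (n + 1) 0 = 0\<close> is the correct coefficient.\<close>

lemma stirling_fps:
  "(\<Prod>i=1..n. 1 + fps_const i * fps_X) $ j = stirling (n + 1) (n + 1 - j)"
proof (induction n arbitrary: j)
  case 0
  show ?case by (cases j) auto
next
  case (Suc n)
  define E where "E = (\<Prod>i=1..n. 1 + fps_const i * fps_X)"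
  have "(\<Prod>i=1..Suc n. 1 + fps_const i * fps_X) $ j = E $ j + Suc n * (fps_X * E) $ j"
  proof -
    have "(\<Prod>i=1..Suc n. 1 + fps_const i * fps_X) = E + fps_const (Suc n) * (fps_X * E)"
      unfolding E_def
      by (subst prod.nat_ivl_Suc', simp) (simp only: distrib_right mult_1_left mult.assoc)
    then show ?thesis by (simp only: fps_add_nth fps_mult_left_const_nth)
  qed
  also have "\<dots> = stirling (Suc n + 1) (Suc n + 1 - j)"
  proof (cases j)
    case 0
    then show ?thesis using Suc.IH [of 0] by (simp add: E_def)
  next
    case (Suc l)
    then show ?thesis using Suc.IH [of j] Suc.IH [of l]
      by (cases "l \<le> n") (simp_all add: E_def Suc_diff_le)
  qed
  finally show ?case .
qed

text \<open>The summand 1 contributes the exponents congruent to 0, the linear summand those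
  congruent to 1. For \<open>s = 0\<close> these classes coincide and positive exponents would count
  twice.\<close>

lemma modular_geometric_fps:
  fixes x :: "'a::comm_semiring_1"
  assumes "s > 0"
  shows "Abs_fps (\<lambda>a. if [a = 0] (mod (s + 1)) \<or> [a = 1] (mod (s + 1)) then x ^ a else 0)
    = (1 + fps_const x * fps_X) * Abs_fps (\<lambda>a. if (s + 1) dvd a then x ^ a else 0)"
proof (rule fps_ext)
  fix a
  show "Abs_fps (\<lambda>a. if [a = 0] (mod (s + 1)) \<or> [a = 1] (mod (s + 1)) then x ^ a else 0) $ a
    = ((1 + fps_const x * fps_X) * Abs_fps (\<lambda>a. if (s + 1) dvd a then x ^ a else 0)) $ a"
  proof (cases a)
    case 0
    then show ?thesis by (simp add: distrib_right mult.assoc)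
  next
    case (Suc b)
    have "[Suc b = 1] (mod (s + 1)) \<longleftrightarrow> (s + 1) dvd b"
      using cong_add_rcancel_nat [of b 1 0 "s + 1"] by (simp add: cong_0_iff)
    moreover have "\<not> ((s + 1) dvd Suc b \<and> (s + 1) dvd b)"
      using assms dvd_add_right_iff [of "s + 1" b 1] by auto
    ultimately show ?thesis
      using Suc by (auto simp: distrib_right mult.assoc cong_0_iff)
  qed
qed

theorem theorem4p2:
  fixes n k s r :: nat
  assumes "s > 0"
    and "r = k mod (s + 1)"
  shows "modular_stirling s n k =
    (\<Sum>i | int i \<le> min ((int n - int r) div int (s + 1)) (int k div int (s + 1)).
       complete_homogeneous (k div (s + 1) - i) n (\<lambda>j. j ^ (s + 1))
         * stirling (n + 1) (n + 1 - r - i * (s + 1)))"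
proof -
  define d q where "d = s + 1" and "q = k div d"
  have d: "d > 0" and r: "r = k mod d"
    using assms by (simp_all add: d_def)
  then have k: "k = r + d * q"
    by (simp only: q_def mod_mult_div_eq)
  \<comment> \<open>The \<open>j\<close>-th summand of the Cauchy product of both generating
    functions at \<open>z ^ k\<close>.\<close>
  define T where "T j = stirling (n + 1) (n + 1 - j) *
      (if d dvd k - j then complete_homogeneous ((k - j) div d) n (\<lambda>j. j ^ d) else 0)" for j
  \<comment> \<open>Integer division rounds down, so \<open>n < r\<close> gives a negative bound and
    an empty range of summation.\<close>
  have le: "int i \<le> (int n - int r) div int d \<longleftrightarrow> r + d * i \<le> n" for i
  proof -
    have "int i \<le> (int n - int r) div int d \<longleftrightarrow> int i * int d \<le> int n - int r"
    proof
      assume "int i \<le> (int n - int r) div int d"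
      then have "int i * int d \<le> (int n - int r) div int d * int d"
        by (rule mult_right_mono) simp
      also have "\<dots> \<le> int n - int r"
        using d by (simp flip: minus_mod_eq_div_mult)
      finally show "int i * int d \<le> int n - int r" .
    next
      assume "int i * int d \<le> int n - int r"
      then have "int i * int d div int d \<le> (int n - int r) div int d"
        using d by (intro zdiv_mono1) auto
      then show "int i \<le> (int n - int r) div int d" using d by simp
    qed
    also have "\<dots> \<longleftrightarrow> int (r + d * i) \<le> int n"
      by (simp add: algebra_simps)
    finally show ?thesis by (simp only: of_nat_le_iff)
  qed
  have "modular_stirling s n k = (\<Sum>j=0..k. T j)"
    unfolding modular_stirling_def modular_symmetric_fps modular_geometric_fps [OF assms(1)]
      prod.distrib fps_mult_nth T_def stirling_fps
    using complete_homogeneous_fps [OF d, of "\<lambda>i. i" n] by (simp add: d_def)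
  \<comment> \<open>A nonzero \<open>T j\<close> forces \<open>j\<close> to be congruent to
    \<open>k\<close>, hence to \<open>r\<close>, modulo \<open>d\<close>, and its Stirling factor
    forces \<open>j \<le> n\<close>.\<close>
  also have "\<dots> = (\<Sum>j\<in>(\<lambda>i. r + d * i) ` {i. i \<le> q \<and> r + d * i \<le> n}. T j)"
  proof (rule sum.mono_neutral_right)
    show "\<forall>j\<in>{0..k} - (\<lambda>i. r + d * i) ` {i. i \<le> q \<and> r + d * i \<le> n}. T j = 0"
    proof
      fix j assume j: "j \<in> {0..k} - (\<lambda>i. r + d * i) ` {i. i \<le> q \<and> r + d * i \<le> n}"
      show "T j = 0"
      proof (rule ccontr)
        assume "T j \<noteq> 0"
        then have dvd: "d dvd k - j" and "stirling (n + 1) (n + 1 - j) \<noteq> 0"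
          by (auto simp: T_def split: if_splits)
        then have "j \<le> n" by (cases "j \<le> n") auto
        have "j mod d = r"
          using dvd j mod_eq_dvd_iff_nat [of j k d] r by auto
        then have "j = r + d * (j div d)" by (metis add.commute mult_div_mod_eq)
        moreover have "j div d \<le> q" using j by (auto simp: q_def intro: div_le_mono)
        ultimately show False using j \<open>j \<le> n\<close> by auto
      qed
    qed
  qed (auto simp: k)
  also have "\<dots> = (\<Sum>i | i \<le> q \<and> r + d * i \<le> n. T (r + d * i))"
    using d by (subst sum.reindex) (auto simp: inj_on_def)
  also have "\<dots> = (\<Sum>i | i \<le> q \<and> r + d * i \<le> n.
      complete_homogeneous (q - i) n (\<lambda>j. j ^ d) * stirling (n + 1) (n + 1 - r - i * d))"
  proof (rule sum.cong [OF refl])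
    fix i assume "i \<in> {i. i \<le> q \<and> r + d * i \<le> n}"
    have "k - (r + d * i) = d * (q - i)"
      by (simp add: k diff_mult_distrib2)
    then show "T (r + d * i)
        = complete_homogeneous (q - i) n (\<lambda>j. j ^ d) * stirling (n + 1) (n + 1 - r - i * d)"
      using d by (simp add: T_def mult.commute)
  qed
  also have "{i. i \<le> q \<and> r + d * i \<le> n}
      = {i. int i \<le> min ((int n - int r) div int d) (int k div int d)}"
    by (auto simp: le q_def zdiv_int [symmetric])
  finally show ?thesis unfolding q_def d_def .
qed

end
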